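(* For every total monotone (increasing) Boolean function $f:\{0,1\}^N\to\{0,1\}$ we have $D(f)\leq Q_0(f)^2$.
   Context: $f$ is monotone increasing if changing input bits from 0 to 1 can never change $f$ from 1 to 0. $D(f)$ is the minimal worst-case number of input bits a deterministic classical decision tree must query to compute $f$. In the quantum query model the input $x$ is accessed only via the gate $|j,b\rangle\mapsto|j,b\oplus x_j\rangle$, interleaved with input-independent unitaries starting from a fixed state, followed by measurement. $Q_0(f)$ is the minimal worst-case number of queries of a zero-error quantum algorithm for $f$: on every input it outputs either $f(x)$ or "don't know", never the wrong value, and outputs "don't know" with probability at most $1/2$. *)

theory Defs
  imports
    "HOL-Library.Extended_Nat"
    "Jordan_Normal_Form.Schur_Decomposition"
begin

text \<open>
  Inputs in \<open>{0,1}^N\<close> are the Boolean lists of length \<open>N\<close>. A Boolean function on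
  \<open>{0,1}^N\<close> is a function on Boolean lists of which only the values on lists of
  length \<open>N\<close> matter. Both complexity measures below take values in \<^typ>\<open>enat\<close>, so
  that the minimum over an empty set of algorithms would be \<open>\<infinity>\<close>, not a junk number.
\<close>

definition inputs :: "nat \<Rightarrow> bool list set" where
  "inputs N = {x. length x = N}"

definition monotone_increasing :: "nat \<Rightarrow> (bool list \<Rightarrow> bool) \<Rightarrow> bool" where
  "monotone_increasing N f \<longleftrightarrow> monotone_on (inputs N) (list_all2 (\<le>)) (\<le>) f"


subsection \<open>Deterministic query complexity\<close>

datatype (queried: 'i) dtree = Leaf bool | Query 'i "'i dtree" "'i dtree"

text \<open>In \<open>Query i l r\<close> the computation continues with \<open>l\<close> if bit \<open>i\<close> is 0, with \<open>r\<close> if it is 1.\<close>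

primrec dtree_output :: "nat dtree \<Rightarrow> bool list \<Rightarrow> bool" where
  "dtree_output (Leaf b) x = b"
| "dtree_output (Query i l r) x = (if x ! i then dtree_output r x else dtree_output l x)"

primrec dtree_cost :: "nat dtree \<Rightarrow> bool list \<Rightarrow> nat" where
  "dtree_cost (Leaf b) x = 0"
| "dtree_cost (Query i l r) x = Suc (if x ! i then dtree_cost r x else dtree_cost l x)"

definition dtree_computes :: "nat \<Rightarrow> (bool list \<Rightarrow> bool) \<Rightarrow> nat dtree \<Rightarrow> bool" where
  "dtree_computes N f t \<longleftrightarrow>
     queried t \<subseteq> {..<N} \<and> (\<forall>x\<in>inputs N. dtree_output t x = f x)"

definition D :: "nat \<Rightarrow> (bool list \<Rightarrow> bool) \<Rightarrow> enat" where
  "D N f = (INF t\<in>{t. dtree_computes N f t}. SUP x\<in>inputs N. enat (dtree_cost t x))"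


subsection \<open>Quantum query algorithms\<close>

text \<open>
  The state space is spanned by the basis states \<open>|j,b,z\<rangle>\<close> with \<open>j < N\<close> an index, \<open>b\<close> a
  bit and \<open>z < W\<close> the content of a workspace of arbitrary dimension \<open>W > 0\<close>. They are
  numbered consecutively, so that states are vectors of dimension \<open>2 * N * W\<close>.
\<close>

definition ket_index :: "nat \<Rightarrow> nat \<Rightarrow> bool \<Rightarrow> nat \<Rightarrow> nat" where
  "ket_index W j b z = (2 * j + of_bool b) * W + z"

text \<open>The gate \<open>|j,b,z\<rangle> \<mapsto> |j, b \<oplus> x\<^sub>j, z\<rangle>\<close>; on Booleans \<open>\<oplus>\<close> is \<open>\<noteq>\<close>.\<close>

definition query_gate :: "nat \<Rightarrow> nat \<Rightarrow> bool list \<Rightarrow> complex mat" where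
  "query_gate N W x = mat (2 * N * W) (2 * N * W)
     (\<lambda>(r, c). of_bool (\<exists>j<N. \<exists>b. \<exists>z<W.
        c = ket_index W j b z \<and> r = ket_index W j (b \<noteq> x ! j) z))"

definition unitary_mat :: "nat \<Rightarrow> complex mat \<Rightarrow> bool" where
  "unitary_mat n U \<longleftrightarrow> U \<in> carrier_mat n n \<and> mat_adjoint U * U = 1\<^sub>m n"

text \<open>
  An algorithm with \<open>T\<close> queries applies \<open>U\<^sub>T O U\<^sub>T\<^sub>-\<^sub>1 O \<dots> O U\<^sub>0\<close> to \<open>|0,0,0\<rangle>\<close>, where \<open>O\<close>
  is the query gate, and then measures in the computational basis. The field \<open>first_unitary\<close> is
  \<open>U\<^sub>0\<close>, the field \<open>later_unitaries\<close> is \<open>[U\<^sub>1, \<dots>, U\<^sub>T]\<close>, and \<open>outcome\<close> turns the observed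
  basis state into an output, \<^const>\<open>None\<close> standing for ``don't know''.
\<close>

record quantum_alg =
  workspace :: nat
  first_unitary :: "complex mat"
  later_unitaries :: "complex mat list"
  outcome :: "nat \<Rightarrow> bool option"

definition quantum_dim :: "nat \<Rightarrow> quantum_alg \<Rightarrow> nat" where
  "quantum_dim N A = 2 * N * workspace A"

definition valid_alg :: "nat \<Rightarrow> quantum_alg \<Rightarrow> bool" where
  "valid_alg N A \<longleftrightarrow>
     workspace A > 0 \<and>
     (\<forall>U \<in> insert (first_unitary A) (set (later_unitaries A)). unitary_mat (quantum_dim N A) U)"

definition num_queries :: "quantum_alg \<Rightarrow> nat" where
  "num_queries A = length (later_unitaries A)"

definition final_state :: "nat \<Rightarrow> quantum_alg \<Rightarrow> bool list \<Rightarrow> complex vec" where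
  "final_state N A x =
     foldl (\<lambda>v U. U *\<^sub>v (query_gate N (workspace A) x *\<^sub>v v))
       (first_unitary A *\<^sub>v unit_vec (quantum_dim N A) (ket_index (workspace A) 0 False 0))
       (later_unitaries A)"

definition output_prob :: "nat \<Rightarrow> quantum_alg \<Rightarrow> bool list \<Rightarrow> bool option \<Rightarrow> real" where
  "output_prob N A x r =
     (\<Sum>i | i < quantum_dim N A \<and> outcome A i = r. (cmod (final_state N A x $ i))\<^sup>2)"

definition zero_error :: "nat \<Rightarrow> (bool list \<Rightarrow> bool) \<Rightarrow> quantum_alg \<Rightarrow> bool" where
  "zero_error N f A \<longleftrightarrow>
     valid_alg N A \<and>
     (\<forall>x\<in>inputs N. output_prob N A x (Some (\<not> f x)) = 0 \<and> output_prob N A x None \<le> 1 / 2)"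

definition Q\<^sub>0 :: "nat \<Rightarrow> (bool list \<Rightarrow> bool) \<Rightarrow> enat" where
  "Q\<^sub>0 N f = (INF A\<in>{A. zero_error N f A}. enat (num_queries A))"

end

theory Submission
  imports Defs
begin

text \<open>
  Let \<open>A\<close> be a zero-error algorithm with \<open>T\<close> queries. Its final amplitudes are polynomials of degree
  at most \<open>T\<close> in the input bits. A minimal certificate of size \<open>k\<close> of a monotone function yields a
  subcube of dimension \<open>k\<close> with one vertex \<open>w\<close> at which \<open>f\<close> differs from its value at all other
  vertices. As \<open>A\<close> is never wrong, some amplitude is nonzero at \<open>w\<close> and zero at the other vertices,
  which forces degree at least \<open>k\<close>. Hence all inputs have certificates of size at most \<open>T\<close>, and
  querying 1-certificates one after the other settles \<open>f\<close> after at most \<open>T\<close> rounds of \<open>T\<close> queries.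
\<close>

subsection \<open>Decision trees from certificates\<close>

definition certificate :: "nat \<Rightarrow> (bool list \<Rightarrow> bool) \<Rightarrow> bool list \<Rightarrow> nat set \<Rightarrow> bool" where
  "certificate N f x K \<longleftrightarrow>
     K \<subseteq> {..<N} \<and> (\<forall>z\<in>inputs N. (\<forall>i\<in>K. z ! i = x ! i) \<longrightarrow> f z = f x)"

text \<open>Correctness and cost are required only on \<open>C\<close>, so that trees for the cells
  of a partition of \<open>C\<close> can be glued together below common queries.\<close>

definition solvable_on :: "nat \<Rightarrow> (bool list \<Rightarrow> bool) \<Rightarrow> bool list set \<Rightarrow> nat \<Rightarrow> bool" where
  "solvable_on N f C c \<longleftrightarrow>
     (\<exists>t. queried t \<subseteq> {..<N} \<and> (\<forall>x\<in>C. dtree_output t x = f x \<and> dtree_cost t x \<le> c))"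

lemma solvable_on_const:
  assumes "\<forall>x\<in>C. f x = b"
  shows "solvable_on N f C c"
  unfolding solvable_on_def using assms by (intro exI[of _ "Leaf b"]) auto

lemma solvable_on_mono: "solvable_on N f C c \<Longrightarrow> c \<le> d \<Longrightarrow> solvable_on N f C d"
  unfolding solvable_on_def by (meson le_trans)

lemma solvable_on_Query:
  assumes "i < N"
    and "solvable_on N f {x\<in>C. x ! i} c"
    and "solvable_on N f {x\<in>C. \<not> x ! i} c"
  shows "solvable_on N f C (Suc c)"
proof -
  obtain r where "queried r \<subseteq> {..<N}"
    "\<forall>x\<in>{x\<in>C. x ! i}. dtree_output r x = f x \<and> dtree_cost r x \<le> c"
    using assms(2) unfolding solvable_on_def by blast
  moreover obtain l where "queried l \<subseteq> {..<N}"
    "\<forall>x\<in>{x\<in>C. \<not> x ! i}. dtree_output l x = f x \<and> dtree_cost l x \<le> c"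
    using assms(3) unfolding solvable_on_def by blast
  ultimately show ?thesis
    unfolding solvable_on_def using assms(1) by (intro exI[of _ "Query i l r"]) auto
qed

text \<open>All of \<open>M\<close> is queried whatever the answers are. Each answer pattern
  occurring in \<open>C\<close> leaves one cell to solve, represented by a member \<open>y\<close>
  of it.\<close>

lemma solvable_on_query_all:
  assumes "finite M" "M \<subseteq> {..<N}"
    and "\<And>y. y \<in> C \<Longrightarrow> solvable_on N f {x\<in>C. \<forall>i\<in>M. x ! i = y ! i} c"
  shows "solvable_on N f C (c + card M)"
  using assms
proof (induction M arbitrary: C rule: finite_induct)
  case empty
  show ?case
  proof (cases "C = {}")
    case True
    then show ?thesis by (simp add: solvable_on_const)
  next
    case False
    then show ?thesis using empty by auto
  qed
next
  case (insert m M)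
  have part: "solvable_on N f {x\<in>C. x ! m = b} (c + card M)" for b
  proof (rule insert.IH)
    fix y assume y: "y \<in> {x\<in>C. x ! m = b}"
    then have "{x\<in>{x\<in>C. x ! m = b}. \<forall>i\<in>M. x ! i = y ! i} = {x\<in>C. \<forall>i\<in>insert m M. x ! i = y ! i}"
      by auto
    then show "solvable_on N f {x\<in>{x\<in>C. x ! m = b}. \<forall>i\<in>M. x ! i = y ! i} c"
      using insert.prems(2)[of y] y by simp
  qed (use insert.prems in auto)
  have "solvable_on N f C (Suc (c + card M))"
    by (rule solvable_on_Query[of m]) (use part[of True] part[of False] insert.prems in auto)
  then show ?case using insert.hyps by simp
qed

text \<open>Otherwise the input that follows \<open>x\<close> on \<open>K\<close> and
  \<open>y\<close> elsewhere would satisfy both certificates, forcing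
  \<open>f x = f y\<close>.\<close>

lemma certificates_intersect:
  assumes "certificate N f x K" "certificate N f y M" "x \<in> inputs N" "f x \<noteq> f y"
  shows "\<exists>i\<in>K \<inter> M. x ! i \<noteq> y ! i"
proof (rule ccontr)
  assume *: "\<not> ?thesis"
  define z where "z = map (\<lambda>i. if i \<in> K then x ! i else y ! i) [0..<N]"
  have "z \<in> inputs N" by (simp add: z_def inputs_def)
  moreover have "\<forall>i\<in>K. z ! i = x ! i"
    using assms(1) by (auto simp: z_def certificate_def)
  moreover have "\<forall>i\<in>M. z ! i = y ! i"
    using assms(2) * by (auto simp: z_def certificate_def subset_iff)
  ultimately show False
    using assms unfolding certificate_def by metis
qed

text \<open>
  The measure \<open>k\<close> counts the unqueried bits in 0-certificates. Querying a 1-certificate decreases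
  it, because a 0-certificate of a remaining input must meet it in an unqueried bit.
\<close>

lemma solvable_on_cylinder:
  assumes one: "\<And>x. x \<in> inputs N \<Longrightarrow> f x \<Longrightarrow> \<exists>M. certificate N f x M \<and> card M \<le> q"
    and "\<forall>x\<in>inputs N. (\<forall>i\<in>A. x ! i = y ! i) \<longrightarrow> \<not> f x \<longrightarrow>
           (\<exists>K. certificate N f x K \<and> card (K - A) \<le> k)"
  shows "solvable_on N f {x\<in>inputs N. \<forall>i\<in>A. x ! i = y ! i} (k * q)"
  using assms(2)
proof (induction k arbitrary: A y)
  case 0
  show ?case
  proof (cases "\<exists>x\<in>inputs N. (\<forall>i\<in>A. x ! i = y ! i) \<and> \<not> f x")
    case True
    then obtain x K where x: "x \<in> inputs N" "\<forall>i\<in>A. x ! i = y ! i" "\<not> f x"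
      and K: "certificate N f x K" "card (K - A) \<le> 0"
      using 0 by blast
    have "finite K" using K(1) unfolding certificate_def using finite_subset by blast
    \<comment> \<open>With no unqueried bit left in \<open>K\<close>, every input of the cylinder
      satisfies this certificate, so \<open>f\<close> is constant there.\<close>
    then have "K \<subseteq> A" using K(2) by simp
    have "f z = f x" if "z \<in> {x\<in>inputs N. \<forall>i\<in>A. x ! i = y ! i}" for z
    proof -
      have "\<forall>i\<in>K. z ! i = x ! i" using that x(2) \<open>K \<subseteq> A\<close> by blast
      then show ?thesis using that K(1) unfolding certificate_def by blast
    qed
    then show ?thesis by (blast intro: solvable_on_const)
  next
    case False
    then show ?thesis by (intro solvable_on_const[where b = True]) auto
  qed
next
  case (Suc k)
  let ?C = "{x\<in>inputs N. \<forall>i\<in>A. x ! i = y ! i}"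
  show ?case
  proof (cases "\<exists>x\<in>?C. f x")
    case False
    then show ?thesis by (intro solvable_on_const[where b = False]) auto
  next
    case True
    then obtain w M where w: "w \<in> ?C" "f w" and M: "certificate N f w M" "card M \<le> q"
      using one by blast
    have fin: "finite M" using M(1) unfolding certificate_def using finite_subset by blast
    have "solvable_on N f ?C (k * q + card M)"
    proof (rule solvable_on_query_all[OF fin])
      show "M \<subseteq> {..<N}" using M(1) by (simp add: certificate_def)
      fix v assume v: "v \<in> ?C"
      \<comment> \<open>The smaller cylinder is anchored at \<open>v\<close>, which agrees with
        \<open>y\<close> on \<open>A\<close> and records the answers on \<open>M\<close>.\<close>
      have "solvable_on N f {x\<in>inputs N. \<forall>i\<in>A \<union> M. x ! i = v ! i} (k * q)"
      proof (rule Suc.IH, intro ballI impI)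
        fix x assume x: "x \<in> inputs N" "\<forall>i\<in>A \<union> M. x ! i = v ! i" "\<not> f x"
        then have xC: "\<forall>i\<in>A. x ! i = y ! i" using v by auto
        then obtain K where K: "certificate N f x K" "card (K - A) \<le> Suc k"
          using Suc.prems x by blast
        obtain m where "m \<in> K \<inter> M" "x ! m \<noteq> w ! m"
          using certificates_intersect[OF K(1) M(1)] x w by blast
        \<comment> \<open>Both \<open>x\<close> and \<open>w\<close> agree with \<open>y\<close> on
          \<open>A\<close>, so a position where they differ lies outside \<open>A\<close>.\<close>
        then have m: "m \<in> K" "m \<in> M" "m \<notin> A" using xC w by auto
        have "finite K" using K(1) unfolding certificate_def using finite_subset by blast
        then have "card (K - (A \<union> M)) < card (K - A)"
          using m by (intro psubset_card_mono) auto
        then show "\<exists>K. certificate N f x K \<and> card (K - (A \<union> M)) \<le> k"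
          using K by (intro exI[of _ K]) auto
      qed
      moreover have "{x\<in>inputs N. \<forall>i\<in>A \<union> M. x ! i = v ! i} = {x\<in>?C. \<forall>i\<in>M. x ! i = v ! i}"
        using v by auto
      ultimately show "solvable_on N f {x\<in>?C. \<forall>i\<in>M. x ! i = v ! i} (k * q)" by simp
    qed
    then show ?thesis
      using M(2) by (auto elim: solvable_on_mono)
  qed
qed

theorem D_le_certificate_product:
  assumes "\<And>x. x \<in> inputs N \<Longrightarrow> f x \<Longrightarrow> \<exists>M. certificate N f x M \<and> card M \<le> q"
    and "\<And>x. x \<in> inputs N \<Longrightarrow> \<not> f x \<Longrightarrow> \<exists>K. certificate N f x K \<and> card K \<le> k"
  shows "D N f \<le> enat (k * q)"
proof -
  have "solvable_on N f (inputs N) (k * q)"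
    \<comment> \<open>With no bit fixed, the cylinder is the whole cube, whatever its
      anchor.\<close>
    using solvable_on_cylinder[of N f q "{}" undefined k] assms by simp
  then obtain t where t: "queried t \<subseteq> {..<N}"
    "\<forall>x\<in>inputs N. dtree_output t x = f x \<and> dtree_cost t x \<le> k * q"
    unfolding solvable_on_def by blast
  then show ?thesis
    unfolding D_def by (intro INF_lower2[of t] SUP_least) (auto simp: dtree_computes_def)
qed


subsection \<open>Certificates of monotone functions\<close>

definition flip :: "bool list \<Rightarrow> nat set \<Rightarrow> bool list" where
  "flip x S = map (\<lambda>i. x ! i \<noteq> (i \<in> S)) [0..<length x]"

lemma length_flip [simp]: "length (flip x S) = length x"
  by (simp add: flip_def)

lemma flip_in_inputs [simp]: "flip x S \<in> inputs N \<longleftrightarrow> x \<in> inputs N"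
  by (simp add: inputs_def)

lemma nth_flip [simp]: "i < length x \<Longrightarrow> flip x S ! i = (x ! i \<noteq> (i \<in> S))"
  by (simp add: flip_def)

lemma flip_empty [simp]: "flip x {} = x"
  by (simp add: list_eq_iff_nth_eq)

lemma flip_insert: "j \<notin> S \<Longrightarrow> flip x (insert j S) = flip (flip x {j}) S"
  by (auto simp: list_eq_iff_nth_eq)

text \<open>
  A minimal certificate \<open>K\<close> of a monotone function embeds OR or AND on the bits in \<open>K\<close>: its
  witness \<open>w\<close> has the value of \<open>x\<close>, and every nonempty change within \<open>K\<close> destroys that value.
\<close>

lemma monotone_certificate:
  assumes mono: "monotone_increasing N f" and x: "x \<in> inputs N"
  obtains K w where "certificate N f x K" "w \<in> inputs N" "f w = f x"
    "\<And>S. S \<subseteq> K \<Longrightarrow> S \<noteq> {} \<Longrightarrow> f (flip w S) \<noteq> f x"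
proof -
  \<comment> \<open>\<open>p K\<close> is the extreme input with bits \<open>f x\<close> on
    \<open>K\<close>: the least one if \<open>f x\<close> holds, the greatest one otherwise. If
    \<open>f\<close> maps it to \<open>f x\<close>, monotonicity extends this value to all inputs
    with these bits on \<open>K\<close>.\<close>
  define p where "p K = map (\<lambda>i. (i \<in> K) = f x) [0..<N]" for K
  let ?P = "\<lambda>K. K \<subseteq> {i. i < N \<and> x ! i = f x} \<and> f (p K) = f x"
  have p_in: "p K \<in> inputs N" for K by (simp add: p_def inputs_def)
  have "p {i. i < N \<and> x ! i = f x} = x"
    using x by (cases "f x") (simp_all add: p_def inputs_def list_eq_iff_nth_eq)
  then have "?P {i. i < N \<and> x ! i = f x}" by simp
  then have "\<exists>K. ?P K \<and> (\<forall>L. ?P L \<longrightarrow> card K \<le> card L)"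
    by (rule ex_has_least_nat)
  then obtain K where K: "K \<subseteq> {i. i < N \<and> x ! i = f x}" "f (p K) = f x"
    and least: "\<forall>L. ?P L \<longrightarrow> card K \<le> card L"
    by (elim exE conjE) (rule that)
  have fin: "finite K" by (rule finite_subset[OF K(1)]) simp
  have cmp: "f a \<longrightarrow> f b"
    if "a \<in> inputs N" "b \<in> inputs N" "\<forall>i<N. a ! i \<longrightarrow> b ! i" for a b
  proof -
    have "list_all2 (\<le>) a b"
      using that by (auto simp: list_all2_conv_all_nth inputs_def)
    then show ?thesis
      using mono that unfolding monotone_increasing_def monotone_on_def by fastforce
  qed
  have "certificate N f x K"
    unfolding certificate_def
  proof (intro conjI ballI impI)
    show "K \<subseteq> {..<N}" using K(1) by auto
    fix z assume z: "z \<in> inputs N" "\<forall>i\<in>K. z ! i = x ! i"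
    then have zK: "\<forall>i\<in>K. z ! i = f x" using K(1) by auto
    show "f z = f x"
    proof (cases "f x")
      case True
      have "f (p K) \<longrightarrow> f z"
        by (rule cmp[OF p_in z(1)]) (use True zK in \<open>auto simp: p_def\<close>)
      then show ?thesis using K(2) True by simp
    next
      case False
      have "f z \<longrightarrow> f (p K)"
        by (rule cmp[OF z(1) p_in]) (use False zK in \<open>auto simp: p_def\<close>)
      then show ?thesis using K(2) False by simp
    qed
  qed
  moreover have "f (flip (p K) S) \<noteq> f x" if "S \<subseteq> K" "S \<noteq> {}" for S
  proof
    assume "f (flip (p K) S) = f x"
    \<comment> \<open>Flipping \<open>S\<close> inside \<open>K\<close> amounts to removing
      \<open>S\<close> from \<open>K\<close>, so a preserved value would contradict the minimality
      of \<open>card K\<close>.\<close>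
    moreover have "flip (p K) S = p (K - S)"
      using that by (auto simp: list_eq_iff_nth_eq p_def)
    ultimately have "card K \<le> card (K - S)"
      using K(1) by (intro least[rule_format] conjI) auto
    moreover have "card (K - S) < card K"
      using that fin by (intro psubset_card_mono) auto
    ultimately show False by simp
  qed
  ultimately show thesis
    using that[of K "p K"] p_in K by blast
qed


subsection \<open>Degree of functions on the Boolean cube\<close>

text \<open>
  On the Boolean cube a function is a polynomial of degree at most \<open>d\<close> iff its alternating sums
  over all subcubes of dimension greater than \<open>d\<close> vanish.
\<close>

definition degree_le :: "nat \<Rightarrow> nat \<Rightarrow> (bool list \<Rightarrow> complex) \<Rightarrow> bool" where
  "degree_le N d g \<longleftrightarrow> (\<forall>x\<in>inputs N. \<forall>B\<subseteq>{..<N}. d < card B \<longrightarrow>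
     (\<Sum>S\<in>Pow B. (-1) ^ card S * g (flip x S)) = 0)"

text \<open>Adding \<open>j\<close> to a subset changes the sign, so the sum over a subcube is the
  difference of the sums over its two opposite faces in direction \<open>j\<close>.\<close>

lemma alternating_sum_insert:
  fixes h :: "nat set \<Rightarrow> complex"
  assumes "finite B" "j \<notin> B"
  shows "(\<Sum>S\<in>Pow (insert j B). (-1) ^ card S * h S) =
         (\<Sum>S\<in>Pow B. (-1) ^ card S * h S) - (\<Sum>S\<in>Pow B. (-1) ^ card S * h (insert j S))"
proof -
  have inj: "inj_on (insert j) (Pow B)" using assms(2) by (auto simp: inj_on_def)
  have "(\<Sum>S\<in>Pow (insert j B). (-1) ^ card S * h S) =
    (\<Sum>S\<in>Pow B. (-1) ^ card S * h S) + (\<Sum>S\<in>insert j ` Pow B. (-1) ^ card S * h S)"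
    unfolding Pow_insert by (rule sum.union_disjoint) (use assms in auto)
  also have "(\<Sum>S\<in>insert j ` Pow B. (-1) ^ card S * h S) =
    (\<Sum>S\<in>Pow B. - ((-1) ^ card S * h (insert j S)))"
    unfolding sum.reindex[OF inj] o_def
  proof (rule sum.cong[OF refl])
    fix S assume "S \<in> Pow B"
    then have "card (insert j S) = Suc (card S)"
      using assms finite_subset[of S B] by (subst card_insert_disjoint) auto
    then show "(-1) ^ card (insert j S) * h (insert j S) = - ((-1) ^ card S * h (insert j S))"
      by simp
  qed
  finally show ?thesis by (simp add: sum_negf)
qed

lemma degree_le_const: "degree_le N 0 (\<lambda>x. c)"
  unfolding degree_le_def
proof (intro ballI allI impI)
  fix x :: "bool list" and B :: "nat set"
  assume "B \<subseteq> {..<N}" "0 < card B"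
  then have "finite B" "B \<noteq> {}" by (auto intro: finite_subset)
  then obtain j B' where "B = insert j B'" "j \<notin> B'" "finite B'"
    by (metis ex_in_conv finite_insert mk_disjoint_insert)
  \<comment> \<open>For a constant function the sums over two opposite faces cancel.\<close>
  then show "(\<Sum>S\<in>Pow B. (-1) ^ card S * c) = 0"
    by (simp add: alternating_sum_insert[of B' j "\<lambda>_. c"])
qed

lemma degree_le_lincomb:
  assumes "\<And>i. i \<in> I \<Longrightarrow> degree_le N d (g i)"
  shows "degree_le N d (\<lambda>x. \<Sum>i\<in>I. a i * g i x)"
  unfolding degree_le_def
proof (intro ballI allI impI)
  fix x B assume x: "x \<in> inputs N" and B: "B \<subseteq> {..<N}" "d < card B"
  have "(\<Sum>S\<in>Pow B. (-1) ^ card S * (\<Sum>i\<in>I. a i * g i (flip x S))) =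
    (\<Sum>S\<in>Pow B. \<Sum>i\<in>I. a i * ((-1) ^ card S * g i (flip x S)))"
    by (simp add: sum_distrib_left mult.left_commute)
  also have "\<dots> = (\<Sum>i\<in>I. a i * (\<Sum>S\<in>Pow B. (-1) ^ card S * g i (flip x S)))"
    by (subst sum.swap) (simp add: sum_distrib_left)
  also have "\<dots> = 0"
    using assms x B by (intro sum.neutral) (simp add: degree_le_def)
  finally show "(\<Sum>S\<in>Pow B. (-1) ^ card S * (\<Sum>i\<in>I. a i * g i (flip x S))) = 0" .
qed

text \<open>Selecting a branch by bit \<open>j\<close> means multiplying by that bit or its
  complement, which costs one degree. For alternating sums: a subcube not extending in direction
  \<open>j\<close> sees one branch only; any other splits into two faces of dimension still above
  \<open>d\<close>, each seeing one branch.\<close>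

lemma degree_le_branch:
  assumes "j < N" and g: "\<And>b. degree_le N d (g b)"
  shows "degree_le N (Suc d) (\<lambda>x. g (x ! j) x)"
  unfolding degree_le_def
proof (intro ballI allI impI)
  fix x B assume x: "x \<in> inputs N" and B: "B \<subseteq> {..<N}" "Suc d < card B"
  have len: "j < length x" using x assms(1) by (simp add: inputs_def)
  have nth: "flip x S ! j = x ! j" if "S \<in> Pow C" "j \<notin> C" for S C
    using that len by auto
  show "(\<Sum>S\<in>Pow B. (-1) ^ card S * g (flip x S ! j) (flip x S)) = 0"
  proof (cases "j \<in> B")
    case False
    then have "(\<Sum>S\<in>Pow B. (-1) ^ card S * g (flip x S ! j) (flip x S)) =
      (\<Sum>S\<in>Pow B. (-1) ^ card S * g (x ! j) (flip x S))"
      by (intro sum.cong refl) (simp only: nth[OF _ False])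
    then show ?thesis using g[of "x ! j"] x B by (simp add: degree_le_def)
  next
    case True
    then obtain B' where B': "B = insert j B'" "j \<notin> B'"
      by (meson mk_disjoint_insert)
    have fin: "finite B'" using B(1) B' by (auto intro: finite_subset)
    then have card: "d < card B'" "B' \<subseteq> {..<N}" using B B' by auto
    have "(\<Sum>S\<in>Pow B'. (-1) ^ card S * g (flip x S ! j) (flip x S)) =
      (\<Sum>S\<in>Pow B'. (-1) ^ card S * g (x ! j) (flip x S))"
      by (intro sum.cong refl) (simp only: nth[OF _ B'(2)])
    \<comment> \<open>The opposite face has base point \<open>flip x {j}\<close>, and bit
      \<open>j\<close> is constantly \<open>\<not> x ! j\<close> on it.\<close>
    moreover have "(\<Sum>S\<in>Pow B'. (-1) ^ card S * g (flip x (insert j S) ! j) (flip x (insert j S))) =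
      (\<Sum>S\<in>Pow B'. (-1) ^ card S * g (\<not> x ! j) (flip (flip x {j}) S))"
    proof (intro sum.cong refl)
      fix S assume "S \<in> Pow B'"
      then have "j \<notin> S" using B'(2) by auto
      then have "flip x (insert j S) ! j = (\<not> x ! j)" using len by simp
      then show "(-1) ^ card S * g (flip x (insert j S) ! j) (flip x (insert j S)) =
        (-1) ^ card S * g (\<not> x ! j) (flip (flip x {j}) S)"
        using flip_insert[OF \<open>j \<notin> S\<close>] by simp
    qed
    ultimately show ?thesis
      using g[of "x ! j"] g[of "\<not> x ! j"] x card
      unfolding B'(1) alternating_sum_insert[OF fin B'(2)] by (simp add: degree_le_def)
  qed
qed


subsection \<open>Amplitudes of quantum query algorithms\<close>

lemma ket_index_less:
  assumes "j < N" "z < W"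
  shows "ket_index W j b z < 2 * N * W"
proof -
  have "ket_index W j b z < (2 * j + of_bool b + 1) * W"
    using assms by (simp add: ket_index_def)
  also have "\<dots> \<le> (2 * N) * W"
    using assms(1) by (intro mult_right_mono) (cases b; simp)+
  finally show ?thesis .
qed

text \<open>The encoding is positional: remainder and quotient by \<open>W\<close> recover
  \<open>z\<close> and \<open>2 * j + of_bool b\<close>, and the parity of the latter is
  \<open>b\<close>.\<close>

lemma ket_index_inject:
  assumes "z < W" "z' < W"
  shows "ket_index W j b z = ket_index W j' b' z' \<longleftrightarrow> j = j' \<and> b = b' \<and> z = z'"
proof
  assume eq: "ket_index W j b z = ket_index W j' b' z'"
  have "z = z'" "2 * j + of_bool b = 2 * j' + of_bool b'"
    using arg_cong[OF eq, of "\<lambda>n. n mod W"] arg_cong[OF eq, of "\<lambda>n. n div W"] assms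
    by (simp_all add: ket_index_def)
  then show "j = j' \<and> b = b' \<and> z = z'"
    by (cases b; cases b'; simp; presburger)
qed simp

lemma ket_index_cases:
  assumes "i < 2 * N * W"
  obtains j b z where "j < N" "z < W" "i = ket_index W j b z"
proof -
  have W: "W > 0" using assms by (cases W) auto
  have d: "i div W < 2 * N" using assms by (simp add: less_mult_imp_div_less)
  have "2 * (i div W div 2) + of_bool (odd (i div W)) = i div W"
    by (simp add: odd_two_times_div_two_succ)
  then have "i = ket_index W (i div W div 2) (odd (i div W)) (i mod W)"
    by (simp add: ket_index_def)
  then show thesis using that[of "i div W div 2" "i mod W"] d W by simp
qed

lemma bij_betw_ket_index:
  "bij_betw (\<lambda>(j, b, z). ket_index W j b z) ({..<N} \<times> UNIV \<times> {..<W}) {..<2 * N * W}"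
  unfolding bij_betw_def
proof
  show "inj_on (\<lambda>(j, b, z). ket_index W j b z) ({..<N} \<times> UNIV \<times> {..<W})"
    by (auto simp: inj_on_def ket_index_inject)
  show "(\<lambda>(j, b, z). ket_index W j b z) ` ({..<N} \<times> UNIV \<times> {..<W}) = {..<2 * N * W}"
  proof (intro equalityI subsetI)
    fix i assume "i \<in> {..<2 * N * W}"
    then obtain j b z where "j < N" "z < W" "i = ket_index W j b z"
      by (auto elim: ket_index_cases)
    then show "i \<in> (\<lambda>(j, b, z). ket_index W j b z) ` ({..<N} \<times> UNIV \<times> {..<W})"
      by (intro image_eqI[of _ _ "(j, b, z)"]) auto
  qed (auto simp: ket_index_less)
qed

lemma query_gate_carrier [simp]: "query_gate N W x \<in> carrier_mat (2 * N * W) (2 * N * W)"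
  by (simp add: query_gate_def)

text \<open>The gate is an involution, so the one column with a nonzero entry in a given row is
  found by the same XOR with \<open>x ! j\<close>.\<close>

lemma query_gate_mult_vec:
  assumes v: "v \<in> carrier_vec (2 * N * W)" and "j < N" "z < W"
  shows "(query_gate N W x *\<^sub>v v) $ ket_index W j b z = v $ ket_index W j (b \<noteq> x ! j) z"
proof -
  let ?n = "2 * N * W" and ?c = "ket_index W j (b \<noteq> x ! j) z"
  have lt: "ket_index W j b z < ?n" "?c < ?n" using assms by (simp_all add: ket_index_less)
  have iff: "(\<exists>j'<N. \<exists>b'. \<exists>z'<W. c = ket_index W j' b' z' \<and>
      ket_index W j b z = ket_index W j' (b' \<noteq> x ! j') z') \<longleftrightarrow> c = ?c" for c
  proof
    assume "c = ?c"
    then have "c = ket_index W j (b \<noteq> x ! j) z \<and>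
      ket_index W j b z = ket_index W j ((b \<noteq> x ! j) \<noteq> x ! j) z"
      by (cases b; cases "x ! j"; simp)
    then show "\<exists>j'<N. \<exists>b'. \<exists>z'<W. c = ket_index W j' b' z' \<and>
      ket_index W j b z = ket_index W j' (b' \<noteq> x ! j') z'"
      using assms(2,3) by blast
  qed (use assms in \<open>auto simp: ket_index_inject\<close>)
  have entry: "query_gate N W x $$ (ket_index W j b z, c) = of_bool (c = ?c)" if "c < ?n" for c
    unfolding query_gate_def index_mat(1)[OF lt(1) that] prod.case iff ..
  have "(query_gate N W x *\<^sub>v v) $ ket_index W j b z = (\<Sum>c<?n. of_bool (c = ?c) * v $ c)"
    using lt(1) v carrier_matD[OF query_gate_carrier, of N W x]
    by (simp only: index_mult_mat_vec scalar_prod_def index_row carrier_vecD lessThan_atLeast0)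
      (intro sum.cong refl, simp only: atLeastLessThan_iff entry index_row)
  also have "\<dots> = (\<Sum>c<?n. if c = ?c then v $ c else 0)"
    by (rule sum.cong[OF refl]) (simp only: of_bool_def if_distrib[of "\<lambda>a. a * _"] mult_1 mult_zero_left)
  also have "\<dots> = v $ ?c" using lt(2) by (simp only: sum.delta finite_lessThan lessThan_iff if_True)
  finally show ?thesis .
qed

section \<open>Norm preservation by query gates and unitaries\<close>

definition sq_norm :: "complex vec \<Rightarrow> real" where
  "sq_norm v = (\<Sum>i<dim_vec v. (cmod (v $ i))\<^sup>2)"

lemma sq_norm_query_gate:
  assumes v: "v \<in> carrier_vec (2 * N * W)"
  shows "sq_norm (query_gate N W x *\<^sub>v v) = sq_norm v"
proof -
  let ?S = "{..<N} \<times> (UNIV :: bool set) \<times> {..<W}"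
  let ?k = "\<lambda>(j, b, z). ket_index W j b z"
  have reindex: "sq_norm u = (\<Sum>s\<in>?S. (cmod (u $ ?k s))\<^sup>2)" if "u \<in> carrier_vec (2 * N * W)" for u
    using that sum.reindex_bij_betw[OF bij_betw_ket_index, of "\<lambda>i. (cmod (u $ i))\<^sup>2" W N]
    by (simp add: sq_norm_def)
  have "query_gate N W x *\<^sub>v v \<in> carrier_vec (2 * N * W)"
    using v by (meson mult_mat_vec_carrier query_gate_carrier)
  then have "sq_norm (query_gate N W x *\<^sub>v v) =
    (\<Sum>s\<in>?S. (cmod ((query_gate N W x *\<^sub>v v) $ ?k s))\<^sup>2)"
    by (rule reindex)
  also have "\<dots> = (\<Sum>s\<in>?S. (cmod (v $ ?k s))\<^sup>2)"
    \<comment> \<open>The coordinate permutation is its own inverse, so it serves as witness in both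
      directions.\<close>
    by (rule sum.reindex_bij_witness[where
          i = "\<lambda>(j, b, z). (j, b \<noteq> x ! j, z)" and j = "\<lambda>(j, b, z). (j, b \<noteq> x ! j, z)"])
      (auto simp: query_gate_mult_vec[OF v])
  also have "\<dots> = sq_norm v" using reindex[OF v] by simp
  finally show ?thesis .
qed

lemma sq_norm_unitary:
  assumes U: "unitary_mat n U" and v: "v \<in> carrier_vec n"
  shows "sq_norm (U *\<^sub>v v) = sq_norm v"
proof -
  have carr: "U \<in> carrier_mat n n" using U by (simp add: unitary_mat_def)
  have sq: "(complex_of_real (cmod c))\<^sup>2 = c * cnj c" for c
    using complex_norm_square[of c] by simp
  \<comment> \<open>The condition on \<open>mat_adjoint U * U\<close>, read entrywise, says that the
    columns of \<open>U\<close> are orthonormal.\<close>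
  have col: "(\<Sum>i<n. U $$ (i, j) * cnj (U $$ (i, k))) = of_bool (j = k)"
    if "j < n" "k < n" for j k
  proof -
    have "(mat_adjoint U * U) $$ (k, j) = (\<Sum>i<n. cnj (U $$ (i, k)) * U $$ (i, j))"
      using that carr by (simp add: mat_adjoint_def scalar_prod_def lessThan_atLeast0)
    then show ?thesis using U that by (auto simp: unitary_mat_def mult.commute)
  qed
  have "complex_of_real (sq_norm (U *\<^sub>v v)) =
    (\<Sum>i<n. (\<Sum>j<n. U $$ (i, j) * v $ j) * cnj (\<Sum>k<n. U $$ (i, k) * v $ k))"
    using carr v
    by (simp add: sq_norm_def sq scalar_prod_def lessThan_atLeast0 del: cnj_sum)
  also have "\<dots> = (\<Sum>i<n. \<Sum>j<n. \<Sum>k<n. (U $$ (i, j) * cnj (U $$ (i, k))) * (v $ j * cnj (v $ k)))"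
    by (simp add: cnj_sum sum_product ac_simps)
  \<comment> \<open>Summing over the rows first isolates the inner products of columns.\<close>
  also have "\<dots> = (\<Sum>j<n. \<Sum>k<n. (\<Sum>i<n. U $$ (i, j) * cnj (U $$ (i, k))) * (v $ j * cnj (v $ k)))"
    by (subst sum.swap, rule sum.cong[OF refl], subst sum.swap) (simp add: sum_distrib_right)
  also have "\<dots> = (\<Sum>j<n. \<Sum>k<n. if j = k then v $ j * cnj (v $ k) else 0)"
    by (intro sum.cong) (auto simp: col)
  also have "\<dots> = complex_of_real (sq_norm v)"
    using v by (simp add: sq_norm_def sq)
  finally show ?thesis using of_real_eq_iff by blast
qed

section \<open>Degree growth of the amplitudes\<close>

lemma degree_le_mult_mat_vec:
  assumes "U \<in> carrier_mat n n" "\<And>x. v x \<in> carrier_vec n"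
    and "\<forall>i<n. degree_le N d (\<lambda>x. v x $ i)"
  shows "\<forall>i<n. degree_le N d (\<lambda>x. (U *\<^sub>v v x) $ i)"
proof (intro allI impI)
  fix i assume "i < n"
  then have "(\<lambda>x. (U *\<^sub>v v x) $ i) = (\<lambda>x. \<Sum>j<n. U $$ (i, j) * v x $ j)"
    using assms(1) carrier_vecD[OF assms(2)]
    by (intro ext) (simp add: scalar_prod_def lessThan_atLeast0)
  then show "degree_le N d (\<lambda>x. (U *\<^sub>v v x) $ i)"
    using assms(3) by (simp only:) (intro degree_le_lincomb, simp)
qed

text \<open>At a fixed basis state the gate picks one of two old amplitudes according to a single
  input bit, which is the situation of \<open>degree_le_branch\<close>.\<close>

lemma degree_le_query_gate:
  assumes "\<And>x. v x \<in> carrier_vec (2 * N * W)"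
    and "\<forall>i<2 * N * W. degree_le N d (\<lambda>x. v x $ i)"
  shows "\<forall>i<2 * N * W. degree_le N (Suc d) (\<lambda>x. (query_gate N W x *\<^sub>v v x) $ i)"
proof (intro allI impI)
  fix i assume "i < 2 * N * W"
  then obtain j b z where i: "j < N" "z < W" "i = ket_index W j b z" by (rule ket_index_cases)
  have "degree_le N (Suc d) (\<lambda>x. v x $ ket_index W j (b \<noteq> x ! j) z)"
    by (rule degree_le_branch[of j N d "\<lambda>b' x. v x $ ket_index W j (b \<noteq> b') z"])
      (use i assms(2) in \<open>auto simp: ket_index_less\<close>)
  then show "degree_le N (Suc d) (\<lambda>x. (query_gate N W x *\<^sub>v v x) $ i)"
    using i assms(1) by (simp add: query_gate_mult_vec)
qed

text \<open>The start state may depend on \<open>x\<close> and has arbitrary degree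
  \<open>d\<close>, so that the induction can absorb one query and one unitary into it.\<close>

lemma run_invariants:
  assumes "\<And>U. U \<in> set Us \<Longrightarrow> unitary_mat (2 * N * W) U"
    and "\<And>x. v x \<in> carrier_vec (2 * N * W)" "\<And>x. sq_norm (v x) = 1"
    and "\<forall>i<2 * N * W. degree_le N d (\<lambda>x. v x $ i)"
  defines "w \<equiv> \<lambda>x. foldl (\<lambda>u U. U *\<^sub>v (query_gate N W x *\<^sub>v u)) (v x) Us"
  shows "w x \<in> carrier_vec (2 * N * W) \<and> sq_norm (w x) = 1 \<and>
    (\<forall>i<2 * N * W. degree_le N (d + length Us) (\<lambda>x. w x $ i))"
  using assms(1-4) unfolding w_def
proof (induction Us arbitrary: v d)
  case Nil
  then show ?case by simp
next
  case (Cons U Us)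
  let ?q = "\<lambda>x. query_gate N W x *\<^sub>v v x"
  have U: "unitary_mat (2 * N * W) U" "U \<in> carrier_mat (2 * N * W) (2 * N * W)"
    using Cons.prems(1)[of U] by (auto simp: unitary_mat_def)
  have q: "?q x \<in> carrier_vec (2 * N * W)" for x
    using Cons.prems(2) by (meson mult_mat_vec_carrier query_gate_carrier)
  have "sq_norm (U *\<^sub>v ?q x) = 1" for x
    using sq_norm_unitary[OF U(1) q] sq_norm_query_gate[OF Cons.prems(2)] Cons.prems(3) by simp
  moreover have "\<forall>i<2 * N * W. degree_le N (Suc d) (\<lambda>x. (U *\<^sub>v ?q x) $ i)"
    by (intro degree_le_mult_mat_vec[OF U(2) q] degree_le_query_gate Cons.prems)
  moreover have "U *\<^sub>v ?q x \<in> carrier_vec (2 * N * W)" for x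
    using U(2) q by (meson mult_mat_vec_carrier)
  ultimately show ?case
    using Cons.IH[of "\<lambda>x. U *\<^sub>v ?q x" "Suc d"] Cons.prems(1) by simp
qed

lemma final_state_invariants:
  assumes A: "valid_alg N A" and "N > 0"
  shows "final_state N A x \<in> carrier_vec (quantum_dim N A)"
    and "sq_norm (final_state N A x) = 1"
    and "i < quantum_dim N A \<Longrightarrow> degree_le N (num_queries A) (\<lambda>x. final_state N A x $ i)"
proof -
  define W n where "W = workspace A" and "n = 2 * N * W"
  define e where "e = (unit_vec n (ket_index W 0 False 0) :: complex vec)"
  \<comment> \<open>\<open>N > 0\<close> makes the dimension positive, so that the start state is a
    genuine basis vector.\<close>
  have lt: "ket_index W 0 False 0 < n"
    using A assms(2) by (simp add: n_def W_def valid_alg_def ket_index_less)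
  have U: "unitary_mat n U" if "U \<in> insert (first_unitary A) (set (later_unitaries A))" for U
    using A that by (auto simp: valid_alg_def quantum_dim_def n_def W_def)
  have e: "e \<in> carrier_vec n" by (simp add: e_def)
  have "sq_norm e = (\<Sum>i<n. if i = ket_index W 0 False 0 then 1 else 0)"
    unfolding sq_norm_def by (intro sum.cong) (auto simp: e_def unit_vec_def)
  then have "sq_norm e = 1" using lt by simp
  then have norm: "sq_norm (first_unitary A *\<^sub>v e) = 1"
    using sq_norm_unitary[OF _ e] U by simp
  have carr: "first_unitary A *\<^sub>v e \<in> carrier_vec n"
    using U e by (intro mult_mat_vec_carrier[of _ n n]) (auto simp: unitary_mat_def)
  have "final_state N A x \<in> carrier_vec n \<and> sq_norm (final_state N A x) = 1 \<and>
    (\<forall>i<n. degree_le N (0 + length (later_unitaries A)) (\<lambda>x. final_state N A x $ i))"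
    unfolding final_state_def quantum_dim_def W_def[symmetric] n_def[symmetric] e_def[symmetric]
    unfolding n_def
    by (rule run_invariants) (use U norm carr degree_le_const in \<open>auto simp: n_def\<close>)
  then show "final_state N A x \<in> carrier_vec (quantum_dim N A)"
    "sq_norm (final_state N A x) = 1"
    "i < quantum_dim N A \<Longrightarrow> degree_le N (num_queries A) (\<lambda>x. final_state N A x $ i)"
    by (simp_all add: n_def W_def quantum_dim_def num_queries_def)
qed

section \<open>Query lower bound for zero-error algorithms\<close>

text \<open>The outcome probabilities sum to 1; "don't know" takes at most half and the wrong answer
  nothing, so the right answer has positive probability.\<close>

lemma zero_error_amplitude:
  assumes A: "zero_error N f A" and "N > 0" and x: "x \<in> inputs N"
  shows "\<exists>i<quantum_dim N A. outcome A i = Some (f x) \<and> final_state N A x $ i \<noteq> 0"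
    and "i < quantum_dim N A \<Longrightarrow> outcome A i = Some (\<not> f x) \<Longrightarrow> final_state N A x $ i = 0"
proof -
  let ?n = "quantum_dim N A" and ?a = "\<lambda>i. (cmod (final_state N A x $ i))\<^sup>2"
  have valid: "valid_alg N A" using A by (simp add: zero_error_def)
  have err: "output_prob N A x (Some (\<not> f x)) = 0" "output_prob N A x None \<le> 1 / 2"
    using A x by (auto simp: zero_error_def)
  show "final_state N A x $ i = 0" if "i < ?n" "outcome A i = Some (\<not> f x)" for i
  proof -
    have "\<forall>i\<in>{i. i < ?n \<and> outcome A i = Some (\<not> f x)}. ?a i = 0"
      using err(1) unfolding output_prob_def
      by (subst (asm) sum_nonneg_eq_0_iff) auto
    then show ?thesis using that by simp
  qed
  have "(\<Sum>r\<in>{None, Some True, Some False}. output_prob N A x r) = (\<Sum>i<?n. ?a i)"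
    unfolding output_prob_def
    by (subst sum.group[symmetric, of "{..<?n}" "{None, Some True, Some False}" "outcome A"])
      (auto simp: lessThan_def simp flip: not_None_eq)
  also have "\<dots> = 1"
    using final_state_invariants(1,2)[OF valid \<open>N > 0\<close>, of x] by (simp add: sq_norm_def)
  finally have "output_prob N A x (Some (f x)) \<noteq> 0"
    using err by (cases "f x") auto
  then show "\<exists>i<?n. outcome A i = Some (f x) \<and> final_state N A x $ i \<noteq> 0"
    unfolding output_prob_def by (metis (mono_tags, lifting) mem_Collect_eq norm_zero
        power_zero_numeral sum.neutral)
qed

lemma zero_error_queries_ge:
  assumes A: "zero_error N f A" and w: "w \<in> inputs N" and B: "B \<subseteq> {..<N}"
    and change: "\<And>S. S \<subseteq> B \<Longrightarrow> S \<noteq> {} \<Longrightarrow> f (flip w S) \<noteq> f w"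
  shows "card B \<le> num_queries A"
proof (rule ccontr)
  assume less: "\<not> ?thesis"
  have fin: "finite B" using B finite_subset by blast
  \<comment> \<open>For \<open>N = 0\<close> the set \<open>B\<close> would be empty and could not
    exceed the number of queries.\<close>
  have "N > 0" using less B by (cases N) auto
  obtain i where i: "i < quantum_dim N A" "outcome A i = Some (f w)" "final_state N A w $ i \<noteq> 0"
    using zero_error_amplitude(1)[OF A \<open>N > 0\<close> w] by blast
  \<comment> \<open>At these vertices the outcome \<open>f w\<close> is the wrong answer.\<close>
  have zero: "final_state N A (flip w S) $ i = 0" if "S \<subseteq> B" "S \<noteq> {}" for S
    using zero_error_amplitude(2)[OF A \<open>N > 0\<close>, of "flip w S" i] change[OF that] w i by auto
  have "degree_le N (num_queries A) (\<lambda>x. final_state N A x $ i)"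
    using final_state_invariants(3)[OF _ \<open>N > 0\<close> i(1)] A by (simp add: zero_error_def)
  then have "0 = (\<Sum>S\<in>Pow B. (-1) ^ card S * final_state N A (flip w S) $ i)"
    using w B less by (simp add: degree_le_def)
  \<comment> \<open>Only the vertex \<open>w\<close> itself, that is \<open>S = {}\<close>,
    contributes.\<close>
  also have "\<dots> = (\<Sum>S\<in>{{}}. (-1) ^ card S * final_state N A (flip w S) $ i)"
    using fin zero by (intro sum.mono_neutral_right) auto
  finally show False using i(3) by simp
qed

theorem theorem7:
  fixes N :: nat and f :: "bool list \<Rightarrow> bool"
  assumes "monotone_increasing N f"
  shows "D N f \<le> (Q\<^sub>0 N f)\<^sup>2"
proof (cases "\<exists>A. zero_error N f A")
  case True
  \<comment> \<open>The infimum of a nonempty set of naturals is attained.\<close>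
  then have "Q\<^sub>0 N f \<in> (\<lambda>A. enat (num_queries A)) ` {A. zero_error N f A}"
    unfolding Q\<^sub>0_def Inf_enat_def by (auto intro: LeastI)
  then obtain A where A: "zero_error N f A" and Q: "Q\<^sub>0 N f = enat (num_queries A)"
    by blast
  have "\<exists>K. certificate N f x K \<and> card K \<le> num_queries A" if x: "x \<in> inputs N" for x
  proof -
    obtain K w where K: "certificate N f x K" "w \<in> inputs N" "f w = f x"
      "\<And>S. S \<subseteq> K \<Longrightarrow> S \<noteq> {} \<Longrightarrow> f (flip w S) \<noteq> f x"
      using monotone_certificate[OF assms x] by blast
    have "card K \<le> num_queries A"
      using K by (intro zero_error_queries_ge[OF A K(2)]) (auto simp: certificate_def)
    then show ?thesis using K(1) by blast
  qed
  \<comment> \<open>The bound holds for inputs of either value, so both certificate sizes are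
    bounded by the number of queries.\<close>
  then have "D N f \<le> enat (num_queries A * num_queries A)"
    by (intro D_le_certificate_product) blast+
  then show ?thesis by (simp add: Q power2_eq_square)
next
  case False
  \<comment> \<open>The infimum over no algorithms is \<open>\<infinity>\<close>, and so is its
    square.\<close>
  then have "Q\<^sub>0 N f = \<infinity>" by (simp add: Q\<^sub>0_def Inf_enat_def)
  then show ?thesis by (simp add: power2_eq_square)
qed

end
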